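(* Let $X$ be a compact metric space, let $f,g\subset X\times X$ be closed relations, and let $B\subset X$ be an attractor block for $f$. Let $\delta=d\big(f,\overline{B}\times\overline{B^c}\big)>0$ and let $0<\epsilon<\delta$. If $g\subset\overline{N}_\epsilon(f)$, then $B$ is an attractor block for $g$.
   Context: A closed relation on $X$ is a closed subset $f\subset X\times X$; for $S\subset X$, $f(S)=\{y\in X:\exists x\in S,\ (x,y)\in f\}$. A set $B\subset X$ is an attractor block for $f$ if $f(\overline B)\subset\operatorname{int}(B)$. Here $B^c=X\setminus B$ and $\overline{B^c}$ is the closure of the complement. The product $X\times X$ carries the metric $d((x,y),(x',y'))=\sqrt{d(x,x')^2+d(y,y')^2}$; the distance between sets is $d(S,S')=\inf\{d(p,p'):p\in S,\ p'\in S'\}$ (equal to $+\infty$ if one of the sets is empty). $\overline N_\epsilon(f)\subset X\times X$ denotes the closed $\epsilon$-neighborhood of $f$ (the set of points at distance at most $\epsilon$ from $f$; empty if $f$ is empty). *)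

theory Defs
  imports "HOL-Analysis.Analysis"
begin

definition closed_relation :: "'a metric \<Rightarrow> ('a \<times> 'a) set \<Rightarrow> bool" where
  "closed_relation X f \<longleftrightarrow> closedin (prod_topology (mtopology_of X) (mtopology_of X)) f"

definition attractor_block :: "'a metric \<Rightarrow> ('a \<times> 'a) set \<Rightarrow> 'a set \<Rightarrow> bool" where
  "attractor_block X f B \<longleftrightarrow>
     B \<subseteq> mspace X \<and> f `` (mtopology_of X closure_of B) \<subseteq> mtopology_of X interior_of B"

(* Extended-real valued, so that the distance is infinite when one of the sets is empty
   (the infimum of the empty set is the top element of ereal); the library's real-valued
   setdist would give 0 there. *)
definition set_distance :: "'a metric \<Rightarrow> 'a set \<Rightarrow> 'a set \<Rightarrow> ereal" where
  "set_distance M S T = (INF p\<in>S. INF q\<in>T. ereal (mdist M p q))"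

definition closed_nbhd :: "'a metric \<Rightarrow> real \<Rightarrow> 'a set \<Rightarrow> 'a set" where
  "closed_nbhd M \<epsilon> S = {p \<in> mspace M. set_distance M {p} S \<le> ereal \<epsilon>}"

end

theory Submission
  imports Defs
begin

text \<open>The complement of the interior of B is the closure of the complement of B. Hence B is an
  attractor block for a relation exactly when that relation misses the closed set K = cl(B) x cl(X -
  B) (\<open>attractor_block_iff_disjoint\<close>). As a closed subset of a compact product, f is
  compact, so its disjointness from K gives a positive distance \<delta>
  (\<open>set_distance_pos_if_compactin_closedin\<close>). A point of g in K would lie within
  \<epsilon> < \<delta> of f, although every point of K is at distance at least \<delta> from every
  point of f; so g misses K too.\<close>

lemma set_distance_le:
  assumes "p \<in> S" "q \<in> T"
  shows "set_distance M S T \<le> ereal (mdist M p q)"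
  unfolding set_distance_def using assms by (intro INF_lower2[of p] INF_lower2[of q]) auto

text \<open>Every point p of S has a ball of radius \<open>r p\<close> that avoids T. Finitely many
  balls of half that radius cover S, and the smallest half-radius bounds the distance from below by
  the triangle inequality.\<close>

lemma set_distance_pos_if_compactin_closedin:
  assumes S: "compactin (mtopology_of M) S" and T: "closedin (mtopology_of M) T"
    and disj: "S \<inter> T = {}"
  shows "0 < set_distance M S T"
proof -
  interpret Metric_space "mspace M" "mdist M" by simp
  have top: "mtopology_of M = mtopology" by (simp add: mtopology_of_def)
  have SM: "S \<subseteq> mspace M" using S by (simp add: top compactin_subspace)
  have TM: "T \<subseteq> mspace M" using T closedin_subset by fastforce
  have "\<exists>r>0. mball p r \<subseteq> mspace M - T" if "p \<in> S" for p
  proof -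
    have "openin mtopology (mspace M - T)" using T by (simp add: top closedin_def)
    moreover have "p \<in> mspace M - T" using that disj SM by auto
    ultimately show ?thesis unfolding openin_mtopology by blast
  qed
  then obtain r where r: "\<And>p. p \<in> S \<Longrightarrow> 0 < r p"
    "\<And>p. p \<in> S \<Longrightarrow> mball p (r p) \<subseteq> mspace M - T" by metis
  have "S \<subseteq> (\<Union>p\<in>S. mball p (r p / 2))" using r(1) SM by fastforce
  moreover have "openin mtopology U" if "U \<in> (\<lambda>p. mball p (r p / 2)) ` S" for U
    using that by blast
  ultimately obtain \<F> where \<F>: "finite \<F>" "\<F> \<subseteq> (\<lambda>p. mball p (r p / 2)) ` S" "S \<subseteq> \<Union>\<F>"
    using compactinD[OF S[unfolded top], of "(\<lambda>p. mball p (r p / 2)) ` S"] by blast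
  obtain F where F: "finite F" "F \<subseteq> S" "S \<subseteq> (\<Union>p\<in>F. mball p (r p / 2))"
    using finite_subset_image[OF \<F>(1,2)] \<F>(3) by blast
  \<comment> \<open>Inserting 1 keeps the minimum meaningful and positive when \<open>F\<close> is
    empty, which can happen if S is empty.\<close>
  define e where "e = Min (insert 1 ((\<lambda>p. r p / 2) ` F))"
  have "0 < e" using F r(1) by (auto simp: e_def)
  have "e \<le> mdist M x q" if "x \<in> S" "q \<in> T" for x q
  proof -
    \<comment> \<open>The centre p is less than \<open>r p / 2\<close> from x but at least
      \<open>r p\<close> from q, which leaves at least \<open>r p / 2\<close> between x and
      q.\<close>
    obtain p where p: "p \<in> F" "x \<in> mball p (r p / 2)" using F(3) \<open>x \<in> S\<close> by blast
    have "q \<notin> mball p (r p)" using r(2) p(1) F(2) \<open>q \<in> T\<close> by blast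
    then have "r p \<le> mdist M p q" using p(2) TM \<open>q \<in> T\<close> by auto
    also have "\<dots> \<le> mdist M p x + mdist M x q"
      using p(2) TM \<open>q \<in> T\<close> by (intro triangle) auto
    finally have "r p / 2 \<le> mdist M x q" using p(2) by auto
    moreover have "e \<le> r p / 2" unfolding e_def using F(1) p(1) by (intro Min_le) auto
    ultimately show ?thesis by linarith
  qed
  then have "ereal e \<le> set_distance M S T"
    unfolding set_distance_def by (auto intro!: INF_greatest)
  then show ?thesis using \<open>0 < e\<close> by (metis ereal_less(2) less_le_trans)
qed

text \<open>The assumption puts the second coordinates of f in the space, where failing to be in the
  interior of B means lying in the closure of its complement.\<close>

lemma attractor_block_iff_disjoint:
  assumes "f \<subseteq> mspace X \<times> mspace X"
  shows "attractor_block X f B \<longleftrightarrow> B \<subseteq> mspace X \<and>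
    f \<inter> (mtopology_of X closure_of B) \<times> (mtopology_of X closure_of (mspace X - B)) = {}"
  using assms closure_of_complement[of "mtopology_of X" B]
  unfolding attractor_block_def by (auto simp: Image_def)

theorem theorem6p3:
  fixes X :: "'a metric" and f g :: "('a \<times> 'a) set" and B :: "'a set" and \<delta> :: ereal
  assumes "compact_space (mtopology_of X)"
    and "closed_relation X f"
    and "closed_relation X g"
    and "attractor_block X f B"
    and "\<delta> = set_distance (prod_metric X X) f
               ((mtopology_of X closure_of B) \<times> (mtopology_of X closure_of (mspace X - B)))"
  shows "0 < \<delta> \<and>
    (\<forall>\<epsilon>::real. 0 < \<epsilon> \<and> ereal \<epsilon> < \<delta> \<and> g \<subseteq> closed_nbhd (prod_metric X X) \<epsilon> f
        \<longrightarrow> attractor_block X g B)"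
proof (intro conjI allI impI)
  let ?K = "(mtopology_of X closure_of B) \<times> (mtopology_of X closure_of (mspace X - B))"
  have fX: "f \<subseteq> mspace X \<times> mspace X" and gX: "g \<subseteq> mspace X \<times> mspace X"
    using assms(2,3) closedin_subset unfolding closed_relation_def by fastforce+
  have disj: "f \<inter> ?K = {}" and BX: "B \<subseteq> mspace X"
    using assms(4) attractor_block_iff_disjoint[OF fX] by blast+
  have "compact_space (prod_topology (mtopology_of X) (mtopology_of X))"
    using assms(1) by (simp add: compact_space_prod_topology)
  then have "compactin (mtopology_of (prod_metric X X)) f"
    using assms(2) by (simp add: closed_relation_def closedin_compact_space)
  moreover have "closedin (mtopology_of (prod_metric X X)) ?K"
    by (simp add: closedin_prod_Times_iff)
  ultimately show "0 < \<delta>"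
    unfolding assms(5) using disj by (rule set_distance_pos_if_compactin_closedin)
  fix \<epsilon> :: real
  assume \<epsilon>: "0 < \<epsilon> \<and> ereal \<epsilon> < \<delta> \<and> g \<subseteq> closed_nbhd (prod_metric X X) \<epsilon> f"
  have "z \<notin> ?K" if "z \<in> g" for z
  proof
    assume "z \<in> ?K"
    interpret Metric_space "mspace (prod_metric X X)" "mdist (prod_metric X X)"
      by (rule Metric_space_mspace_mdist)
    \<comment> \<open>The strict bound makes the infimum yield an actual point of f closer to z than
      \<delta>, with no need for it to be attained. It also excludes an empty f, whose distance from
      z would be infinite.\<close>
    have "set_distance (prod_metric X X) {z} f < \<delta>"
      using \<epsilon> \<open>z \<in> g\<close> by (auto simp: closed_nbhd_def)
    then obtain p where "p \<in> f" "ereal (mdist (prod_metric X X) z p) < \<delta>"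
      unfolding set_distance_def by (auto simp: INF_less_iff)
    moreover have "\<delta> \<le> ereal (mdist (prod_metric X X) p z)"
      unfolding assms(5) using \<open>p \<in> f\<close> \<open>z \<in> ?K\<close> by (rule set_distance_le)
    ultimately show False by (metis commute not_less)
  qed
  then show "attractor_block X g B"
    using BX attractor_block_iff_disjoint[OF gX] by blast
qed

end
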